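(* Let $q = p^n$, where $p$ is a prime number and $n\ge 2$ is an integer, let $\delta\in\{1,2\}$, and assume $n\ge 5$ if $p=2$ and $\delta=2$. Let $a_0,\ldots,a_{n-\delta}\in\mathfrak{S}_q$ be the permutations defined in the context. Every $t\in\{0,1,\ldots,q-1\}$ is written uniquely as $t = t_0 + t_1 p^{\delta} + t_2 p^{\delta+1} + \cdots + t_{n-\delta} p^{n-1}$ with $t_0 \in \{0,\ldots,p^{\delta}-1\}$ and $t_1,\ldots,t_{n-\delta} \in \{0,\ldots,p-1\}$. Let $f\in\mathbb{F}_q[X_1,X_2]$ be the permutation group polynomial whose permutation polynomial tuple is $\underline{\beta}_{f} = (\beta_0, \beta_1, \ldots, \beta_{q-1})$ with $\beta_{t} = a_0^{t_0}a_1^{t_1} \cdots a_{n-\delta}^{t_{n-\delta}}$. Define $h :\mathbb{F}_q \rightarrow \mathbb{F}_q$ by $$h(c_{t})=\begin{cases} a_0^{t_0}a_1^{t_1}a_2^{t_2}\cdots a_{n-\delta}^{t_{n-\delta}}(c_{t}) & \text{if } p \text{ is odd},\\ a_0^{t_{n-1}}a_1^{t_0 + t_{n-1}}a_2^{t_1}a_3^{t_2}\cdots a_{n-1}^{t_{n-2}}(c_{t}) & \text{if } p=2,\ \delta=1,\\ a_0^{t_{n-2} + 2t_{n-3}} a_1^{t_{00} + S_1^t-t_1} a_2^{t_{01} +S_2^t-t_2} a_3^{t_1} a_4^{t_2} \cdots a_{n-2}^{t_{n-4}}(c_{t}) & \text{if } p=2,\ \delta=2, \end{cases}$$ where, in the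 case $p=2$, $\delta=2$, one writes $t_0 = t_{00} + 2t_{01}$ with unique $t_{00}, t_{01} \in \{0,1\}$, and $$S_1^{t}=\sum_{k=1}^{\lfloor (n-3)/2 \rfloor}(t_{2k-1} + t_{2k+1}) \bmod 2, \qquad S_2^{t}=\sum_{k=1}^{\lfloor (n-4)/2 \rfloor}(t_{2k} + t_{2k+2}) \bmod 2.$$ Then the bivariate local permutation polynomial $g(X_1,X_2)$ corresponding to the permutation polynomial tuple $(h\beta_0, h\beta_1, \ldots, h\beta_{q-1})$ is a companion of $f$.
   Context: Let $\mathbb{F}_q = \{c_0, \ldots, c_{q-1}\}$ be a fixed listing, and let $\mathfrak{S}_q$ be the symmetric group on the set $\mathbb{F}_q$ (products are compositions). Polynomials over $\mathbb{F}_q$ are taken with degree less than $q$ in each variable, i.e. identified with functions. A polynomial $f\in\mathbb{F}_q[X_1,X_2]$ is a local permutation polynomial (LPP) if $f(a,X_2)$ and $f(X_1,a)$ are permutation polynomials of $\mathbb{F}_q$ for every $a\in\mathbb{F}_q$. LPPs correspond bijectively to permutation polynomial tuples, i.e. tuples $\underline{\beta}_f=(\beta_0,\ldots,\beta_{q-1})\in\mathfrak{S}_q^q$ such that $\beta_i\beta_j^{-1}$ has no fixed points for $i\ne j$, via $f(x,\beta_i(x))=c_i$ for all $x\in\mathbb{F}_q$ and all $i$. If $\{\beta_0,\ldots,\beta_{q-1}\}$ is a subgroup of $\mathfrak{S}_q$, then $f$ is called a permutation group polynomial. Two LPPs $f_1,f_2\in\mathbb{F}_q[X_1,X_2]$ are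 companions of each other (orthogonal) if for all $(a,b)\in\mathbb{F}_q\times\mathbb{F}_q$ the system $f_1(X_1,X_2)=a$, $f_2(X_1,X_2)=b$ has a unique solution in $\mathbb{F}_q\times\mathbb{F}_q$. For $\delta\in\{1,2\}$: $a_0 := \prod_{j=0}^{p^{n-\delta}-1} (c_{jp^{\delta}}, c_{jp^{\delta}+1}, \ldots, c_{jp^{\delta}+p^{\delta}-1})$ and, for $1\le i\le n-\delta$, $a_i := \prod_{j} (c_{j}, c_{j+p^{i+\delta-1}}, \ldots, c_{j+(p-1)p^{i+\delta-1}})$, where the product is over all $0\le j\le q-1$ with $(j \bmod p^{i+\delta}) < p^{i+\delta-1}$. These permutations generate an Abelian subgroup $G=\{ a_0^{i_0} \cdots a_{n-\delta}^{i_{n-\delta}} \mid 0 \leq i_0 \leq p^{\delta}-1,\ 0 \leq i_1, \ldots, i_{n-\delta} \leq p-1 \}$ of $\mathfrak{S}_q$ of order $q$, in which no non-identity element has a fixed point. Empty sums are $0$. *)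

theory Defs
  imports
    "HOL-Algebra.Bij"
    "HOL-Combinatorics.Cycles"
    "HOL-Library.Cardinality"
    "HOL-Computational_Algebra.Polynomial"
    "HOL-Computational_Algebra.Primes"
begin

text \<open>
  Throughout, the field of order \<open>q\<close> is a type \<open>'a\<close> of class \<open>{field, finite}\<close>, so that
  \<open>q = CARD('a)\<close>, and its listing \<open>c\<^sub>0, \<dots>, c\<^sub>q\<^sub>-\<^sub>1\<close> is a function \<open>c :: nat \<Rightarrow> 'a\<close> of which
  only the values on \<open>{..<q}\<close> matter; likewise for tuples \<open>\<beta> :: nat \<Rightarrow> 'a \<Rightarrow> 'a\<close>.
\<close>

abbreviation Sym :: "('a \<Rightarrow> 'a) monoid" where
  "Sym \<equiv> BijGroup (UNIV :: 'a set)"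

subsection \<open>Bivariate polynomials\<close>

text \<open>
  An element \<open>f :: 'a poly poly\<close> is a polynomial in \<open>X\<^sub>2\<close> with coefficients in \<open>F\<^sub>q[X\<^sub>1]\<close>.
  The first two definitions below are \<open>f(a, X\<^sub>2)\<close> and \<open>f(X\<^sub>1, a)\<close>.
\<close>

definition subst_fst :: "'a :: comm_ring_1 poly poly \<Rightarrow> 'a \<Rightarrow> 'a poly" where
  "subst_fst f a = map_poly (\<lambda>r. poly r a) f"

definition subst_snd :: "'a :: comm_ring_1 poly poly \<Rightarrow> 'a \<Rightarrow> 'a poly" where
  "subst_snd f a = poly f [:a:]"

definition eval2 :: "'a :: comm_ring_1 poly poly \<Rightarrow> 'a \<Rightarrow> 'a \<Rightarrow> 'a" where
  "eval2 f x y = poly (poly f [:y:]) x"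

definition reduced :: "'a :: {field, finite} poly poly \<Rightarrow> bool" where
  "reduced f \<longleftrightarrow> degree f < CARD('a) \<and> (\<forall>i. degree (coeff f i) < CARD('a))"

definition permutation_polynomial :: "'a :: {field, finite} poly \<Rightarrow> bool" where
  "permutation_polynomial u \<longleftrightarrow> bij (poly u)"

definition local_permutation_polynomial :: "'a :: {field, finite} poly poly \<Rightarrow> bool" where
  "local_permutation_polynomial f \<longleftrightarrow> reduced f \<and>
     (\<forall>a. permutation_polynomial (subst_fst f a) \<and> permutation_polynomial (subst_snd f a))"

definition companions ::
  "'a :: {field, finite} poly poly \<Rightarrow> 'a poly poly \<Rightarrow> bool" where
  "companions f1 f2 \<longleftrightarrow>
     local_permutation_polynomial f1 \<and> local_permutation_polynomial f2 \<and>
     (\<forall>a b. \<exists>!z :: 'a \<times> 'a. eval2 f1 (fst z) (snd z) = a \<and> eval2 f2 (fst z) (snd z) = b)"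

subsection \<open>Permutation polynomial tuples\<close>

definition permutation_polynomial_tuple :: "(nat \<Rightarrow> 'a :: {field, finite} \<Rightarrow> 'a) \<Rightarrow> bool" where
  "permutation_polynomial_tuple \<beta> \<longleftrightarrow>
     (\<forall>i<CARD('a). \<beta> i \<in> carrier Sym) \<and>
     (\<forall>i<CARD('a). \<forall>j<CARD('a). i \<noteq> j \<longrightarrow>
        (\<forall>x. (\<beta> i \<otimes>\<^bsub>Sym\<^esub> inv\<^bsub>Sym\<^esub> (\<beta> j)) x \<noteq> x))"

definition has_tuple ::
  "(nat \<Rightarrow> 'a :: {field, finite}) \<Rightarrow> 'a poly poly \<Rightarrow> (nat \<Rightarrow> 'a \<Rightarrow> 'a) \<Rightarrow> bool" where
  "has_tuple c f \<beta> \<longleftrightarrow> permutation_polynomial_tuple \<beta> \<and>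
     (\<forall>x. \<forall>i<CARD('a). eval2 f x (\<beta> i x) = c i)"

text \<open>
  By the lemma \<open>ex1_lpp_of_tuple\<close> below, the following description is proper for every
  permutation polynomial tuple \<open>\<beta>\<close>.
\<close>

definition lpp_of_tuple ::
  "(nat \<Rightarrow> 'a :: {field, finite}) \<Rightarrow> (nat \<Rightarrow> 'a \<Rightarrow> 'a) \<Rightarrow> 'a poly poly" where
  "lpp_of_tuple c \<beta> = (THE f. local_permutation_polynomial f \<and> has_tuple c f \<beta>)"

definition permutation_group_polynomial ::
  "(nat \<Rightarrow> 'a :: {field, finite}) \<Rightarrow> 'a poly poly \<Rightarrow> bool" where
  "permutation_group_polynomial c f \<longleftrightarrow> local_permutation_polynomial f \<and>
     (\<exists>\<beta>. has_tuple c f \<beta> \<and> subgroup (\<beta> ` {..<CARD('a)}) Sym)"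

subsection \<open>The permutations \<open>a\<^sub>0, \<dots>, a\<^sub>n\<^sub>-\<^sub>\<delta>\<close>\<close>

text \<open>
  The library's \<open>cycle_of_list [x\<^sub>1, \<dots>, x\<^sub>k]\<close>
  sends \<open>x\<^sub>i\<close> to \<open>x\<^sub>i\<^sub>+\<^sub>1\<close> and \<open>x\<^sub>k\<close> to \<open>x\<^sub>1\<close>; the product of \<open>Sym\<close> is composition,
  the right factor being applied first.
\<close>

text \<open>The ordered product \<open>g\<^sub>1 g\<^sub>2 \<cdots> g\<^sub>k\<close> of the members of a list.\<close>

definition perm_prod :: "('a \<Rightarrow> 'a) list \<Rightarrow> 'a \<Rightarrow> 'a" where
  "perm_prod gs = foldr (\<lambda>g h. g \<otimes>\<^bsub>Sym\<^esub> h) gs \<one>\<^bsub>Sym\<^esub>"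

definition gen :: "(nat \<Rightarrow> 'a) \<Rightarrow> nat \<Rightarrow> nat \<Rightarrow> nat \<Rightarrow> nat \<Rightarrow> 'a \<Rightarrow> 'a" where
  "gen c p n \<delta> i =
     (if i = 0 then
        perm_prod (map (\<lambda>j. cycle_of_list (map (\<lambda>k. c (j * p ^ \<delta> + k)) [0..<p ^ \<delta>]))
          [0..<p ^ (n - \<delta>)])
      else
        perm_prod (map (\<lambda>j. cycle_of_list (map (\<lambda>k. c (j + k * p ^ (i + \<delta> - 1))) [0..<p]))
          (filter (\<lambda>j. j mod p ^ (i + \<delta>) < p ^ (i + \<delta> - 1)) [0..<p ^ n])))"

text \<open>The product \<open>a\<^sub>0\<^bsup>e 0\<^esup> a\<^sub>1\<^bsup>e 1\<^esup> \<cdots> a\<^sub>n\<^sub>-\<^sub>\<delta>\<^bsup>e (n - \<delta>)\<^esup>\<close>, for integer exponents.\<close>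

definition gen_prod ::
  "(nat \<Rightarrow> 'a) \<Rightarrow> nat \<Rightarrow> nat \<Rightarrow> nat \<Rightarrow> (nat \<Rightarrow> int) \<Rightarrow> 'a \<Rightarrow> 'a" where
  "gen_prod c p n \<delta> e = perm_prod (map (\<lambda>i. gen c p n \<delta> i [^]\<^bsub>Sym\<^esub> e i) [0..<n - \<delta> + 1])"

subsection \<open>Digits\<close>

text \<open>\<open>digit p \<delta> t i\<close> is \<open>t\<^sub>i\<close>; see \<open>digit_expansion\<close> and \<open>digit_unique\<close> below.\<close>

definition digit :: "nat \<Rightarrow> nat \<Rightarrow> nat \<Rightarrow> nat \<Rightarrow> nat" where
  "digit p \<delta> t i = (if i = 0 then t mod p ^ \<delta> else t div p ^ (i + \<delta> - 1) mod p)"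

text \<open>
  The exponent of \<open>a\<^sub>i\<close> in the definition of \<open>h(c\<^sub>t)\<close>. It is an integer since
  \<open>t\<^sub>0\<^sub>0 + S\<^sub>1 - t\<^sub>1\<close> and \<open>t\<^sub>0\<^sub>1 + S\<^sub>2 - t\<^sub>2\<close> may be negative. A prime that is not odd is \<open>2\<close>.
\<close>

definition h_exp :: "nat \<Rightarrow> nat \<Rightarrow> nat \<Rightarrow> nat \<Rightarrow> nat \<Rightarrow> int" where
  "h_exp p n \<delta> t i =
     (let d = (\<lambda>k. int (digit p \<delta> t k));
          d00 = d 0 mod 2;
          d01 = d 0 div 2;
          S1 = (\<Sum>k = 1..(n - 3) div 2. d (2 * k - 1) + d (2 * k + 1)) mod 2;
          S2 = (\<Sum>k = 1..(n - 4) div 2. d (2 * k) + d (2 * k + 2)) mod 2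
      in
        if odd p then d i
        else if \<delta> = 1 then
          (if i = 0 then d (n - 1)
           else if i = 1 then d 0 + d (n - 1)
           else d (i - 1))
        else
          (if i = 0 then d (n - 2) + 2 * d (n - 3)
           else if i = 1 then d00 + S1 - d 1
           else if i = 2 then d01 + S2 - d 2
           else d (i - 2)))"

subsection \<open>Correctness of the digits\<close>

lemma digit_bounds:
  assumes "p > 0"
  shows "digit p \<delta> t 0 < p ^ \<delta>" "i > 0 \<Longrightarrow> digit p \<delta> t i < p"
  using assms by (auto simp: digit_def)

lemma digit_expansion_aux:
  "t mod p ^ (\<delta> + m) = digit p \<delta> t 0 + (\<Sum>i = 1..m. digit p \<delta> t i * p ^ (i + \<delta> - 1))"
proof (induction m)
  case 0
  then show ?case by (simp add: digit_def)
next
  case (Suc m)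
  have "t mod p ^ (\<delta> + Suc m) = p ^ (\<delta> + m) * (t div p ^ (\<delta> + m) mod p) + t mod p ^ (\<delta> + m)"
    using mod_mult2_eq[of t "p ^ (\<delta> + m)" p] by (simp add: mult.commute)
  then show ?case
    using Suc by (simp add: digit_def add.commute mult.commute)
qed

lemma digit_expansion:
  assumes "t < p ^ n" "\<delta> \<le> n"
  shows "t = digit p \<delta> t 0 + (\<Sum>i = 1..n - \<delta>. digit p \<delta> t i * p ^ (i + \<delta> - 1))"
  using digit_expansion_aux[of t p \<delta> "n - \<delta>"] assms by simp

lemma digit_unique_aux:
  fixes s :: "nat \<Rightarrow> nat"
  assumes "p > 0" "s 0 < p ^ \<delta>" "\<And>i. 1 \<le> i \<Longrightarrow> i \<le> m \<Longrightarrow> s i < p"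
  defines "t \<equiv> s 0 + (\<Sum>i = 1..m. s i * p ^ (i + \<delta> - 1))"
  shows "t < p ^ (\<delta> + m) \<and> (\<forall>i\<le>m. digit p \<delta> t i = s i)"
  using assms(3) unfolding t_def
proof (induction m)
  case 0
  then show ?case using assms(2) by (simp add: digit_def)
next
  case (Suc m)
  define u where "u = s 0 + (\<Sum>i = 1..m. s i * p ^ (i + \<delta> - 1))"
  have IH: "u < p ^ (\<delta> + m)" "\<And>i. i \<le> m \<Longrightarrow> digit p \<delta> u i = s i"
    using Suc unfolding u_def by auto
  have eq: "s 0 + (\<Sum>i = 1..Suc m. s i * p ^ (i + \<delta> - 1)) = u + s (Suc m) * p ^ (\<delta> + m)"
    by (simp add: u_def add.commute)
  have lt: "s (Suc m) < p" using Suc.prems by simp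
  have "u + s (Suc m) * p ^ (\<delta> + m) < p ^ (\<delta> + m) + s (Suc m) * p ^ (\<delta> + m)"
    using IH(1) by simp
  also have "\<dots> = Suc (s (Suc m)) * p ^ (\<delta> + m)" by simp
  also have "\<dots> \<le> p * p ^ (\<delta> + m)" using lt by (intro mult_right_mono) auto
  finally have bound: "u + s (Suc m) * p ^ (\<delta> + m) < p ^ (\<delta> + Suc m)" by simp
  have "digit p \<delta> (u + s (Suc m) * p ^ (\<delta> + m)) i = s i" if "i \<le> Suc m" for i
  proof (cases "i = Suc m")
    case True
    then show ?thesis using IH(1) lt \<open>p > 0\<close> by (simp add: digit_def add.commute)
  next
    case False
    then have i: "i \<le> m" using that by simp
    have "digit p \<delta> (u + s (Suc m) * p ^ (\<delta> + m)) i = digit p \<delta> u i"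
    proof (cases "i = 0")
      case True
      then show ?thesis by (simp add: digit_def power_add mult.assoc mult.left_commute)
    next
      case False
      define r where "r = s (Suc m) * p ^ (m - i)"
      have "\<delta> + m = (i + \<delta> - 1) + Suc (m - i)" using i False by simp
      then have "p ^ (\<delta> + m) = p ^ (i + \<delta> - 1) * (p * p ^ (m - i))"
        by (metis power_add power_Suc)
      then have "u + s (Suc m) * p ^ (\<delta> + m) = u + p ^ (i + \<delta> - 1) * (p * r)"
        by (simp add: r_def)
      then show ?thesis using False \<open>p > 0\<close> by (simp add: digit_def)
    qed
    then show ?thesis using IH(2)[OF i] by simp
  qed
  then show ?case using bound eq by auto
qed

lemma digit_unique:
  fixes s :: "nat \<Rightarrow> nat"
  assumes "p > 0" "s 0 < p ^ \<delta>" "\<And>i. 1 \<le> i \<Longrightarrow> i \<le> n - \<delta> \<Longrightarrow> s i < p"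
    and "t = s 0 + (\<Sum>i = 1..n - \<delta>. s i * p ^ (i + \<delta> - 1))" "i \<le> n - \<delta>"
  shows "digit p \<delta> t i = s i"
  using digit_unique_aux[of p s \<delta> "n - \<delta>"] assms by auto

subsection \<open>Local permutation polynomials and tuples correspond\<close>

lemma poly_subst_fst: "poly (subst_fst f a) y = eval2 f a y"
proof (induction f)
  case 0
  then show ?case by (simp add: subst_fst_def eval2_def)
next
  case (pCons r f)
  have "subst_fst (pCons r f) a = pCons (poly r a) (subst_fst f a)"
    unfolding subst_fst_def by (simp add: map_poly_pCons)
  then show ?case using pCons by (simp add: eval2_def)
qed

lemma poly_subst_snd: "poly (subst_snd f a) x = eval2 f x a"
  by (simp add: subst_snd_def eval2_def)

lemma degree_map_poly_less:
  assumes "f 0 = 0" "degree u < k"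
  shows "degree (map_poly f u) < k"
proof -
  have "degree (map_poly f u) \<le> degree u"
    using assms(1) by (intro degree_le) (auto simp: coeff_map_poly coeff_eq_0)
  then show ?thesis using assms(2) by simp
qed

lemma reduced_eqI:
  fixes f g :: "'a :: {field, finite} poly poly"
  assumes "reduced f" "reduced g" "\<And>x y. eval2 f x y = eval2 g x y"
  shows "f = g"
proof (rule poly_eqI, rule poly_eqI_degree[where A = UNIV])
  fix i and x :: 'a
  have deg: "degree (subst_fst u x) < CARD('a)" if "reduced u" for u
    using that by (auto simp: reduced_def subst_fst_def intro!: degree_map_poly_less)
  have "subst_fst f x = subst_fst g x"
    by (rule poly_eqI_degree[where A = UNIV]) (auto simp: poly_subst_fst assms deg)
  then have "coeff (subst_fst f x) i = coeff (subst_fst g x) i" by simp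
  then show "poly (coeff f i) x = poly (coeff g i) x"
    by (simp add: subst_fst_def coeff_map_poly)
qed (use assms in \<open>auto simp: reduced_def\<close>)

lemma ex_reduced_eval2:
  fixes F :: "'a :: {field, finite} \<Rightarrow> 'a \<Rightarrow> 'a"
  shows "\<exists>f. reduced f \<and> (\<forall>x y. eval2 f x y = F x y)"
proof -
  define L :: "'a \<Rightarrow> 'a poly" where
    "L a = (\<Prod>b\<in>UNIV - {a}. smult (inverse (a - b)) [:- b, 1:])" for a
  have L: "poly (L a) x = (if x = a then 1 else 0)" for a x
  proof (cases "x = a")
    case True
    have "poly (smult (inverse (a - b)) [:- b, 1:]) x = 1" if "b \<in> UNIV - {a}" for b
    proof -
      have "poly (smult (inverse (a - b)) [:- b, 1:]) x = inverse (a - b) * (a - b)"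
        by (simp add: True algebra_simps)
      also have "\<dots> = 1" using that by (intro left_inverse) simp
      finally show ?thesis .
    qed
    then have "poly (L a) x = 1" unfolding L_def poly_prod by (rule prod.neutral[OF ballI])
    then show ?thesis using True by simp
  next
    case False
    have "poly (L a) x = 0"
      unfolding L_def poly_prod
      by (rule prod_zero[OF finite], rule bexI[of _ x]) (use False in simp_all)
    then show ?thesis using False by simp
  qed
  have degL: "degree (L a) < CARD('a)" for a
  proof -
    have "degree (L a) \<le> (\<Sum>b\<in>UNIV - {a}. degree (smult (inverse (a - b)) [:- b, 1:]))"
      unfolding L_def by (rule order.trans[OF degree_prod_sum_le]) (auto simp: o_def)
    also have "\<dots> \<le> (\<Sum>b\<in>UNIV - {a}. 1)" by (rule sum_mono) auto
    also have "\<dots> < CARD('a)" by (simp add: card_Diff_singleton)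
    finally show ?thesis .
  qed
  define f where "f = (\<Sum>b\<in>UNIV. \<Sum>a\<in>UNIV. map_poly (\<lambda>r. smult (F a b * r) (L a)) (L b))"
  have "eval2 (map_poly (\<lambda>r. smult (k * r) u) v) x y = k * poly u x * poly v y"
    for k x y :: 'a and u v
  proof (induction v)
    case 0
    then show ?case by (simp add: eval2_def)
  next
    case (pCons r v)
    then show ?case by (simp add: eval2_def map_poly_pCons algebra_simps)
  qed
  moreover have "eval2 (sum u A) x y = (\<Sum>i\<in>A. eval2 (u i) x y)"
    for u :: "'a \<Rightarrow> 'a poly poly" and A x y
    by (simp add: eval2_def poly_sum)
  ultimately have "eval2 f x y = (\<Sum>b\<in>UNIV. \<Sum>a\<in>UNIV. F a b * poly (L a) x * poly (L b) y)" for x y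
    by (simp add: f_def)
  moreover have "(\<Sum>b\<in>UNIV. \<Sum>a\<in>UNIV. F a b * poly (L a) x * poly (L b) y) = F x y" for x y
  proof -
    have "(\<Sum>b\<in>UNIV. \<Sum>a\<in>UNIV. F a b * poly (L a) x * poly (L b) y) =
        (\<Sum>b\<in>UNIV. if b = y then \<Sum>a\<in>UNIV. if a = x then F a b else 0 else 0)"
    proof (rule sum.cong)
      fix b :: 'a
      have "F a b * poly (L a) x * poly (L b) y = (if b = y then if a = x then F a b else 0 else 0)" for a
        by (simp add: L)
      then show "(\<Sum>a\<in>UNIV. F a b * poly (L a) x * poly (L b) y) =
          (if b = y then \<Sum>a\<in>UNIV. if a = x then F a b else 0 else 0)"
        by simp
    qed simp
    also have "\<dots> = F x y" by simp
    finally show ?thesis .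
  qed
  ultimately have "eval2 f x y = F x y" for x y by simp
  moreover have "reduced f"
    unfolding reduced_def
  proof (intro conjI allI)
    have "degree (map_poly (\<lambda>r. smult (F a b * r) (L a)) (L b)) < CARD('a)" for a b
      by (intro degree_map_poly_less degL) simp
    then have "degree (map_poly (\<lambda>r. smult (F a b * r) (L a)) (L b)) \<le> CARD('a) - 1" for a b
      by (metis Suc_pred' less_Suc_eq_le zero_less_card_finite)
    then have "degree f \<le> CARD('a) - 1"
      unfolding f_def by (intro degree_sum_le) auto
    then show "degree f < CARD('a)"
      using zero_less_card_finite[where 'a = 'a] by linarith
    fix i
    have "degree (L a) \<le> CARD('a) - 1" for a
      using degL[of a] by linarith
    then have "degree (coeff f i) \<le> CARD('a) - 1"
      unfolding f_def coeff_sum by (intro degree_sum_le) (auto simp: coeff_map_poly)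
    then show "degree (coeff f i) < CARD('a)"
      using zero_less_card_finite[where 'a = 'a] by linarith
  qed
  ultimately show ?thesis by blast
qed

lemma bij_betw_permutation_polynomial_tuple:
  fixes \<beta> :: "nat \<Rightarrow> 'a :: {field, finite} \<Rightarrow> 'a"
  assumes "permutation_polynomial_tuple \<beta>"
  shows "bij_betw (\<lambda>i. \<beta> i x) {..<CARD('a)} UNIV"
proof -
  have "inj_on (\<lambda>i. \<beta> i x) {..<CARD('a)}"
  proof (rule inj_onI, rule ccontr)
    fix i j assume *: "i \<in> {..<CARD('a)}" "j \<in> {..<CARD('a)}" "\<beta> i x = \<beta> j x" "i \<noteq> j"
    then have ij: "\<beta> i \<in> Bij UNIV" "\<beta> j \<in> Bij UNIV"
      using assms by (auto simp: permutation_polynomial_tuple_def BijGroup_def)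
    define \<gamma> where "\<gamma> = inv\<^bsub>Sym\<^esub> (\<beta> j)"
    have \<gamma>: "\<gamma> = (\<lambda>y\<in>UNIV. inv_into UNIV (\<beta> j) y)"
      unfolding \<gamma>_def by (rule inv_BijGroup[OF ij(2)])
    have "inj (\<beta> j)" using ij(2) by (simp add: Bij_def bij_betw_def)
    then have "\<gamma> (\<beta> j x) = x" by (simp add: \<gamma>)
    moreover have "\<gamma> \<in> Bij UNIV" unfolding \<gamma> by (rule restrict_inv_into_Bij[OF ij(2)])
    ultimately have "(\<beta> i \<otimes>\<^bsub>Sym\<^esub> \<gamma>) (\<beta> j x) = \<beta> j x"
      using ij(1) *(3) by (simp add: BijGroup_def compose_def)
    then show False
      using assms *(1,2,4) unfolding permutation_polynomial_tuple_def lessThan_iff \<gamma>_def by blast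
  qed
  then show ?thesis
    by (simp add: bij_betw_def card_image card_subset_eq)
qed

lemma ex1_lpp_of_tuple:
  fixes c :: "nat \<Rightarrow> 'a :: {field, finite}"
  assumes "bij_betw c {..<CARD('a)} UNIV" "permutation_polynomial_tuple \<beta>"
  shows "\<exists>!f. local_permutation_polynomial f \<and> has_tuple c f \<beta>"
proof -
  let ?q = "CARD('a)"
  define idx where "idx x y = the_inv_into {..<?q} (\<lambda>i. \<beta> i x) y" for x y
  note bb = bij_betw_permutation_polynomial_tuple[OF assms(2)]
  have idx: "idx x (\<beta> i x) = i" if "i < ?q" for i x
    unfolding idx_def using that bb[of x] by (intro the_inv_into_f_f) (auto simp: bij_betw_def)
  have idx': "idx x y < ?q" "\<beta> (idx x y) x = y" for x y
    using f_the_inv_into_f_bij_betw[OF bb[of x], of y]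
      bij_betw_the_inv_into[OF bb[of x]] unfolding idx_def bij_betw_def by auto
  obtain f where f: "reduced f" "\<And>x y. eval2 f x y = c (idx x y)"
    using ex_reduced_eval2[of "\<lambda>x y. c (idx x y)"] by blast
  have cinj: "i = j" if "c i = c j" "i < ?q" "j < ?q" for i j
    using assms(1) that by (auto simp: bij_betw_def inj_on_def)
  have "inj (poly (subst_fst f a))" for a
    by (rule injI) (metis poly_subst_fst f(2) cinj idx')
  moreover have "inj (poly (subst_snd f a))" for a
  proof (rule injI)
    fix x y assume "poly (subst_snd f a) x = poly (subst_snd f a) y"
    then have i: "idx x a = idx y a"
      by (metis poly_subst_snd f(2) cinj idx'(1))
    have "inj (\<beta> (idx x a))"
      using assms(2) idx'(1)[of x a]
      by (auto simp: permutation_polynomial_tuple_def BijGroup_def Bij_def bij_betw_def)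
    then show "x = y" using i idx'(2) by (metis injD)
  qed
  ultimately have lpp: "local_permutation_polynomial f"
    using f(1)
    by (simp add: local_permutation_polynomial_def permutation_polynomial_def bij_def
        finite_UNIV_inj_surj)
  show ?thesis
  proof (rule ex1I[of _ f])
    show "local_permutation_polynomial f \<and> has_tuple c f \<beta>"
      using lpp assms(2) by (simp add: has_tuple_def f idx)
  next
    fix g assume g: "local_permutation_polynomial g \<and> has_tuple c g \<beta>"
    show "g = f"
    proof (rule reduced_eqI)
      fix x y
      show "eval2 g x y = eval2 f x y"
        using g idx'[of x y] by (auto simp: has_tuple_def f) metis
    qed (use g f in \<open>auto simp: local_permutation_polynomial_def\<close>)
  qed
qed

end

theory Submission
  imports Defs "HOL-Number_Theory.Cong"
begin

text \<open>
  Identify \<open>c\<^sub>t\<close> with the vector of mixed-radix digits of \<open>t\<close> in the Abelian group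
  \<open>A = \<int>/p\<^sup>\<delta> \<times> (\<int>/p)\<^sup>n\<^sup>-\<^sup>\<delta>\<close>. Then \<open>a\<^sub>i\<close> adds the \<open>i\<close>-th unit vector, \<open>\<beta>\<^sub>t\<close> is translation by \<open>t\<close>,
  and \<open>h(v) = v + E(v)\<close> where \<open>E\<close> is the vector of exponents. Hence \<open>f(x, y) = y - x\<close> and
  \<open>g(x, y) = h\<inverse>(y) - x\<close>; with \<open>v = h\<inverse>(y)\<close> the system \<open>g = a\<close>, \<open>f = b\<close> becomes \<open>v - x = a\<close>,
  \<open>E(v) = b - a\<close>. So everything reduces to the injectivity of \<open>E\<close> and of \<open>id + E\<close> on \<open>A\<close>.
\<close>

subsection \<open>Permutations and ordered products\<close>

lemma mult_BijGroup_UNIV: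
  assumes "bij f" "bij g"
  shows "f \<otimes>\<^bsub>Sym\<^esub> g = f \<circ> g"
  using assms by (auto simp: BijGroup_def Bij_def compose_def)

lemma carrier_BijGroup_UNIV: "f \<in> carrier Sym \<longleftrightarrow> bij f"
  by (simp add: BijGroup_def Bij_def)

lemma one_BijGroup_UNIV: "\<one>\<^bsub>Sym\<^esub> = id"
  by (auto simp: BijGroup_def)

lemma inv_BijGroup_UNIV:
  assumes "bij f"
  shows "inv\<^bsub>Sym\<^esub> f = inv_into UNIV f"
  using assms inv_BijGroup[of f UNIV] by (auto simp: Bij_def)

lemma perm_prod_Nil: "perm_prod [] = id"
  by (simp add: perm_prod_def one_BijGroup_UNIV)

lemma bij_perm_prod:
  assumes "\<And>g. g \<in> set gs \<Longrightarrow> bij g"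
  shows "bij (perm_prod gs)"
  using assms
proof (induction gs)
  case Nil
  show ?case unfolding perm_prod_Nil by (rule bij_id)
next
  case (Cons g gs)
  then have "bij (perm_prod gs)" "bij g" by auto
  moreover have "perm_prod (g # gs) = g \<otimes>\<^bsub>Sym\<^esub> perm_prod gs" by (simp add: perm_prod_def)
  ultimately show ?case by (metis mult_BijGroup_UNIV bij_comp)
qed

lemma perm_prod_Cons:
  assumes "\<And>h. h \<in> set (g # gs) \<Longrightarrow> bij h"
  shows "perm_prod (g # gs) = g \<circ> perm_prod gs"
proof -
  have "perm_prod (g # gs) = g \<otimes>\<^bsub>Sym\<^esub> perm_prod gs" by (simp add: perm_prod_def)
  then show ?thesis using assms bij_perm_prod[of gs] by (simp add: mult_BijGroup_UNIV)
qed

text \<open>The map \<open>r\<close> labels a point by its cycle. \<open>C j\<close> moves only the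
  fibre over \<open>j\<close> and keeps it inside itself, so at most one factor acts on
  \<open>x\<close> and no other factor touches the result. Products of disjoint cycles are evaluated
  in this way.\<close>

lemma perm_prod_fibres:
  assumes "distinct js" "\<And>j. j \<in> set js \<Longrightarrow> C j permutes {x. r x = j}"
  shows "perm_prod (map C js) x = (if r x \<in> set js then C (r x) x else x)"
  using assms
proof (induction js)
  case Nil
  then show ?case by (simp add: perm_prod_Nil)
next
  case (Cons j js)
  have "bij h" if "h \<in> set (map C (j # js))" for h
    using that Cons.prems(2) permutes_bij by (auto simp del: list.map)
  then have "perm_prod (map C (j # js)) = C j \<circ> perm_prod (map C js)"
    using perm_prod_Cons[of "C j" "map C js"] by simp
  moreover have "C j y = y" if "r y \<noteq> j" for y
    using Cons.prems(2)[of j] that by (auto simp: permutes_def)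
  moreover have "r (C k y) = k" if "r y = k" "k \<in> set js" for k y
    using permutes_in_image[OF Cons.prems(2), of k y] that by auto
  moreover have "r x \<noteq> j" "r (C (r x) x) \<noteq> j" if "r x \<in> set js"
    using that calculation(3) Cons.prems(1) by auto
  ultimately show ?case using Cons by auto
qed

lemma cycle_of_list_upt:
  assumes "inj_on f {..<r}" "k < r"
  shows "cycle_of_list (map f [0..<r]) (f k) = f (Suc k mod r)"
proof -
  let ?cs = "map f [0..<r]"
  have "distinct ?cs" using assms(1) by (simp add: distinct_map atLeast0LessThan)
  then have "map (cycle_of_list ?cs) ?cs = rotate 1 ?cs"
    using cyclic_rotation[of ?cs 1] by simp
  then have "map (cycle_of_list ?cs) ?cs ! k = rotate 1 ?cs ! k" by simp
  then show ?thesis using assms(2) by (simp add: nth_rotate del: rotate_Suc)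
qed

text \<open>Substituting \<open>g y\<close> for \<open>x\<close> removes the inverse, so tuples can
  be tested by pointwise distinctness.\<close>

lemma mult_inv_BijGroup_no_fixed_point_iff:
  assumes "bij f" "bij g"
  shows "(\<forall>x. (f \<otimes>\<^bsub>Sym\<^esub> inv\<^bsub>Sym\<^esub> g) x \<noteq> x) \<longleftrightarrow> (\<forall>x. f x \<noteq> g x)"
proof -
  have "(f \<otimes>\<^bsub>Sym\<^esub> inv\<^bsub>Sym\<^esub> g) x = f (inv_into UNIV g x)" for x
    using assms by (simp add: inv_BijGroup_UNIV mult_BijGroup_UNIV bij_imp_bij_inv)
  then show ?thesis
    by (metis assms(2) bij_inv_eq_iff)
qed

lemma permutation_polynomial_tuple_iff:
  fixes \<beta> :: "nat \<Rightarrow> 'a :: {field, finite} \<Rightarrow> 'a"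
  shows "permutation_polynomial_tuple \<beta> \<longleftrightarrow>
    (\<forall>i<CARD('a). bij (\<beta> i)) \<and>
    (\<forall>i<CARD('a). \<forall>j<CARD('a). i \<noteq> j \<longrightarrow> (\<forall>x. \<beta> i x \<noteq> \<beta> j x))"
  unfolding permutation_polynomial_tuple_def carrier_BijGroup_UNIV
  by (intro conj_cong refl all_cong imp_cong mult_inv_BijGroup_no_fixed_point_iff) simp_all

subsection \<open>The exponent maps for \<open>p = 2\<close>\<close>

text \<open>Peels off one digit: summands already known to be congruent cancel, and reduced
  representatives that are congruent coincide.\<close>

lemma cong_add_cancel_eq:
  fixes a b s s' m :: int
  assumes "[a + s = b + s'] (mod m)" "[s = s'] (mod m)" "a \<in> {0..<m}" "b \<in> {0..<m}"
  shows "a = b"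
proof -
  have "[a + s - s = b + s' - s'] (mod m)" using assms(1,2) by (rule cong_diff)
  then show ?thesis using assms(3,4) by (simp add: cong_def)
qed

text \<open>The exponents for \<open>p = 2\<close>, \<delta> = 1, detached from natural numbers and
  stated for an arbitrary integer vector whose top index is \<open>m = n - 1\<close>.\<close>

definition exponent1 :: "nat \<Rightarrow> (nat \<Rightarrow> int) \<Rightarrow> nat \<Rightarrow> int" where
  "exponent1 m d i = (if i = 0 then d m else if i = 1 then d 0 + d m else d (i - 1))"

text \<open>Here \<open>m = n - 2\<close>, so \<open>(m - 1) div 2\<close> is
  \<open>(n - 3) div 2\<close>; this bound keeps \<open>2 * k + 1\<close> at most \<open>m\<close>.
  The reduction modulo 2 is left to \<open>exponent2\<close>, so that the sums themselves can be
  compared by congruence.\<close>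

definition odd_pairs :: "nat \<Rightarrow> (nat \<Rightarrow> int) \<Rightarrow> int" where
  "odd_pairs m d = (\<Sum>k = 1..(m - 1) div 2. d (2 * k - 1) + d (2 * k + 1))"

definition even_pairs :: "nat \<Rightarrow> (nat \<Rightarrow> int) \<Rightarrow> int" where
  "even_pairs m d = (\<Sum>k = 1..(m - 2) div 2. d (2 * k) + d (2 * k + 2))"

definition exponent2 :: "nat \<Rightarrow> (nat \<Rightarrow> int) \<Rightarrow> nat \<Rightarrow> int" where
  "exponent2 m d i =
    (if i = 0 then d m + 2 * d (m - 1)
     else if i = 1 then d 0 mod 2 + odd_pairs m d mod 2 - d 1
     else if i = 2 then d 0 div 2 + even_pairs m d mod 2 - d 2
     else d (i - 2))"

lemma h_exp_odd: "odd p \<Longrightarrow> h_exp p n \<delta> t i = int (digit p \<delta> t i)"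
  by (simp add: h_exp_def)

lemma h_exp_two_one: "h_exp 2 n 1 t i = exponent1 (n - 1) (\<lambda>k. int (digit 2 1 t k)) i"
  by (simp add: h_exp_def exponent1_def Let_def)

lemma h_exp_two_two: "h_exp 2 n 2 t i = exponent2 (n - 2) (\<lambda>k. int (digit 2 2 t k)) i"
proof -
  have "n - 2 - 1 = n - 3" "n - 2 - 2 = n - 4" by simp_all
  then show ?thesis unfolding h_exp_def exponent2_def odd_pairs_def even_pairs_def Let_def by simp
qed

text \<open>The system is triangular: component 0 is the top digit, component 1 then yields digit 0,
  and the other components are the remaining digits themselves.\<close>

lemma exponent1_inj:
  assumes "m \<ge> 1" "\<And>i. x i \<in> {0..<2}" "\<And>i. y i \<in> {0..<2}"
    and cong: "\<And>i. i \<le> m \<Longrightarrow> [exponent1 m x i = exponent1 m y i] (mod 2)"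
    and "k \<le> m"
  shows "x k = y k"
proof -
  have xm: "x m = y m"
    using cong_add_cancel_eq[OF _ cong_refl[of 0] assms(2,3)] cong[of 0] by (simp add: exponent1_def)
  then have x0: "x 0 = y 0"
    using cong_add_cancel_eq[OF _ cong_refl[of "y m"] assms(2,3)] cong[of 1] assms(1)
    by (simp add: exponent1_def)
  have "x k = y k" if "0 < k" "k < m"
    using cong_add_cancel_eq[OF _ cong_refl[of 0] assms(2,3), of k k] cong[of "Suc k"] that
    by (simp add: exponent1_def)
  then show ?thesis using xm x0 assms(5) by (cases "k = 0"; cases "k = m") auto
qed

text \<open>Component 1 is digit 1 plus component 0, so digit 1 comes first. Each later component
  adds two neighbouring digits and passes equality upwards; the top digit finally yields digit 0
  through component 0.\<close>

lemma exponent1_add_inj: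
  assumes "m \<ge> 1" "\<And>i. x i \<in> {0..<2}" "\<And>i. y i \<in> {0..<2}"
    and cong: "\<And>i. i \<le> m \<Longrightarrow> [x i + exponent1 m x i = y i + exponent1 m y i] (mod 2)"
    and "k \<le> m"
  shows "x k = y k"
proof -
  note cancel = cong_add_cancel_eq[OF _ _ assms(2,3)]
  have c0: "[x 0 + x m = y 0 + y m] (mod 2)" using cong[of 0] by (simp add: exponent1_def)
  have pos: "x (Suc i) = y (Suc i)" if "Suc i \<le> m" for i
    using that
  proof (induction i)
    case 0
    then show ?case using cong[of 1] cancel[OF _ c0, of 1 1] by (simp add: exponent1_def)
  next
    case (Suc i)
    then have "x (Suc i) = y (Suc i)" by simp
    then show ?case using cong[of "Suc (Suc i)"] Suc.prems
        cancel[OF _ cong_refl[of "y (Suc i)"], of "Suc (Suc i)" "Suc (Suc i)"]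
      by (simp add: exponent1_def)
  qed
  then have "x m = y m" using assms(1) by (cases m) auto
  then have "x 0 = y 0" using c0 cancel[OF _ cong_refl[of "y m"], of 0 0] by simp
  then show ?thesis using pos assms(5) by (cases k) auto
qed

lemma two_digit_cong:
  fixes a b c d :: int
  assumes "[a + 2 * b = c + 2 * d] (mod 4)"
    and "a \<in> {0..<2}" "b \<in> {0..<2}" "c \<in> {0..<2}" "d \<in> {0..<2}"
  shows "a = c" "b = d"
proof -
  have "a + 2 * b = c + 2 * d"
    by (rule cong_add_cancel_eq[OF _ cong_refl[of 0]]) (use assms in auto)
  moreover have "a = 0 \<or> a = 1" "c = 0 \<or> c = 1" using assms(2,4) by auto
  ultimately show "a = c" "b = d" by presburger+
qed

text \<open>Components 3 and above are the digits 1 to \<open>m - 2\<close>, and component 0 encodes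
  the last two in base 2. The pair sums then agree, so components 1 and 2 give the two bits of digit
  0.\<close>

lemma exponent2_inj:
  assumes "m \<ge> 3" "\<And>i. 0 < i \<Longrightarrow> x i \<in> {0..<2}" "\<And>i. 0 < i \<Longrightarrow> y i \<in> {0..<2}"
    and "x 0 \<in> {0..<4}" "y 0 \<in> {0..<4}"
    and cong0: "[exponent2 m x 0 = exponent2 m y 0] (mod 4)"
    and cong: "\<And>i. 0 < i \<Longrightarrow> i \<le> m \<Longrightarrow> [exponent2 m x i = exponent2 m y i] (mod 2)"
    and "k \<le> m"
  shows "x k = y k"
proof -
  have top: "x m = y m" "x (m - 1) = y (m - 1)"
    using two_digit_cong[of "x m" "x (m - 1)" "y m" "y (m - 1)"] cong0 assms(1-3)
    by (auto simp: exponent2_def)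
  have mid: "x i = y i" if "0 < i" "i + 2 \<le> m" for i
    using cong_add_cancel_eq[OF _ cong_refl[of 0] assms(2,3), of i i] cong[of "i + 2"] that
    by (simp add: exponent2_def)
  have pos: "x i = y i" if i: "0 < i" "i \<le> m" for i
  proof -
    consider "i + 2 \<le> m" | "i = m" | "i = m - 1" using i by linarith
    then show ?thesis using top mid i by cases auto
  qed
  have S1: "odd_pairs m x = odd_pairs m y"
    unfolding odd_pairs_def by (rule sum.cong) (auto simp: pos)
  have S2: "even_pairs m x = even_pairs m y"
    unfolding even_pairs_def by (rule sum.cong) (auto simp: pos)
  have "[x 0 mod 2 + (odd_pairs m y mod 2 - y 1) = y 0 mod 2 + (odd_pairs m y mod 2 - y 1)] (mod 2)"
    using cong[of 1] assms(1) pos[of 1] S1 by (simp add: exponent2_def add_diff_eq)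
  then have "x 0 mod 2 = y 0 mod 2"
    by (rule cong_add_cancel_eq[OF _ cong_refl]) auto
  moreover have "[x 0 div 2 + (even_pairs m y mod 2 - y 2) = y 0 div 2 + (even_pairs m y mod 2 - y 2)] (mod 2)"
    using cong[of 2] assms(1) pos[of 2] S2 by (simp add: exponent2_def add_diff_eq)
  then have "x 0 div 2 = y 0 div 2"
    by (rule cong_add_cancel_eq[OF _ cong_refl]) (use assms(4,5) in auto)
  ultimately have "x 0 = y 0" by (metis div_mult_mod_eq)
  then show ?thesis using pos assms(8) by (cases "k = 0") auto
qed

text \<open>
  Modulo \<open>2\<close>, the two sums of pairs are sums of the coordinates \<open>3, 5, \<dots>\<close> and \<open>4, 6, \<dots>\<close> of the
  image, so they cancel before any digit is known.
\<close>

lemma exponent2_add_inj: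
  assumes "m \<ge> 3" "\<And>i. 0 < i \<Longrightarrow> x i \<in> {0..<2}" "\<And>i. 0 < i \<Longrightarrow> y i \<in> {0..<2}"
    and "x 0 \<in> {0..<4}" "y 0 \<in> {0..<4}"
    and cong0: "[x 0 + exponent2 m x 0 = y 0 + exponent2 m y 0] (mod 4)"
    and cong: "\<And>i. 0 < i \<Longrightarrow> i \<le> m \<Longrightarrow>
      [x i + exponent2 m x i = y i + exponent2 m y i] (mod 2)"
    and "k \<le> m"
  shows "x k = y k"
proof -
  \<comment> \<open>Past the three special components, component \<open>i + 2\<close> is exactly a
    summand of one of the pair sums.\<close>
  have step: "[x i + x (i + 2) = y i + y (i + 2)] (mod 2)" if "0 < i" "i + 2 \<le> m" for i
    using cong[of "i + 2"] that by (simp add: exponent2_def add.commute)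
  have "[odd_pairs m x = odd_pairs m y] (mod 2)"
    unfolding odd_pairs_def
  proof (rule cong_sum)
    fix k assume k: "k \<in> {1..(m - 1) div 2}"
    then have "2 * k - 1 + 2 = 2 * k + 1" "2 * k + 1 \<le> m" "0 < 2 * k - 1" by auto
    then show "[x (2 * k - 1) + x (2 * k + 1) = y (2 * k - 1) + y (2 * k + 1)] (mod 2)"
      using step[of "2 * k - 1"] by simp
  qed
  then have "[odd_pairs m x mod 2 = odd_pairs m y mod 2] (mod 2)" by simp
  \<comment> \<open>The term \<open>- d 1\<close> in the exponent cancels the digit added to it,
    leaving only a bit of digit 0 and the pair sum. Component 2 behaves likewise.\<close>
  moreover have "[x 0 mod 2 + odd_pairs m x mod 2 = y 0 mod 2 + odd_pairs m y mod 2] (mod 2)"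
    using cong[of 1] assms(1) by (simp add: exponent2_def)
  ultimately have "x 0 mod 2 = y 0 mod 2"
    using cong_add_cancel_eq[of "x 0 mod 2" "odd_pairs m x mod 2" "y 0 mod 2" "odd_pairs m y mod 2" 2]
    by auto
  moreover have "[even_pairs m x = even_pairs m y] (mod 2)"
    unfolding even_pairs_def by (rule cong_sum, rule step) auto
  then have "[even_pairs m x mod 2 = even_pairs m y mod 2] (mod 2)" by simp
  moreover have "[x 0 div 2 + even_pairs m x mod 2 = y 0 div 2 + even_pairs m y mod 2] (mod 2)"
    using cong[of 2] assms(1) by (simp add: exponent2_def)
  ultimately have "x 0 div 2 = y 0 div 2" "x 0 mod 2 = y 0 mod 2"
    using cong_add_cancel_eq[of "x 0 div 2" "even_pairs m x mod 2" "y 0 div 2" "even_pairs m y mod 2" 2]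
      assms(4,5) by auto
  then have x0: "x 0 = y 0" by (metis div_mult_mod_eq)
  have "[x m + 2 * x (m - 1) = y m + 2 * y (m - 1)] (mod 4)"
    using cong0 x0 by (simp add: exponent2_def cong_add_lcancel)
  then have top: "x m = y m" "x (m - 1) = y (m - 1)"
    using two_digit_cong[of "x m" "x (m - 1)" "y m" "y (m - 1)"] assms(1-3) by auto
  \<comment> \<open>Descent by twos from the top pair of digits; \<open>j\<close> is the distance
    from the top.\<close>
  have pos: "x (m - j) = y (m - j)" if "j < m" for j
    using that
  proof (induction j rule: less_induct)
    case (less j)
    show ?case
    proof (cases "j < 2")
      case True
      then have "j = 0 \<or> j = 1" by auto
      then show ?thesis using top by auto
    next
      case False
      then have eq: "m - j + 2 = m - (j - 2)" using less.prems by simp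
      then have "x (m - j + 2) = y (m - j + 2)" using less.IH[of "j - 2"] less.prems False by simp
      then show ?thesis
        using step[of "m - j"] less.prems False
          cong_add_cancel_eq[OF _ cong_refl[of "y (m - j + 2)"] assms(2,3), of "m - j" "m - j"]
        by simp
    qed
  qed
  show ?thesis using x0 pos[of "m - k"] assms(8) by (cases "k = 0") auto
qed

subsection \<open>Translations of the digit group\<close>

definition radix :: "nat \<Rightarrow> nat \<Rightarrow> nat \<Rightarrow> nat" where
  "radix p \<delta> i = (if i = 0 then p ^ \<delta> else p)"

text \<open>Index 0 is separate because the general formula would give
  \<open>p ^ (\<delta> - 1)\<close> there.\<close>

definition place :: "nat \<Rightarrow> nat \<Rightarrow> nat \<Rightarrow> nat" where
  "place p \<delta> i = (if i = 0 then 1 else p ^ (i + \<delta> - 1))"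

lemma digit_eq: "digit p \<delta> t i = t div place p \<delta> i mod radix p \<delta> i"
  by (simp add: digit_def radix_def place_def)

lemma digit_zero: "digit p \<delta> 0 i = 0"
  by (simp add: digit_def)

lemma sum_atMost_place:
  "(\<Sum>i\<le>m. s i * place p \<delta> i) = s 0 + (\<Sum>i = 1..m. s i * p ^ (i + \<delta> - 1))"
  by (simp add: atMost_atLeast0 sum.atLeast_Suc_atMost place_def)

locale listing =
  fixes c :: "nat \<Rightarrow> 'a" and p n \<delta> :: nat
  assumes p_pos: "p > 0" and \<delta>_le: "\<delta> \<le> n"
    and bij_c: "bij_betw c {..<p ^ n} UNIV"
begin

abbreviation "dg \<equiv> digit p \<delta>"
abbreviation "rad \<equiv> radix p \<delta>"
abbreviation "pl \<equiv> place p \<delta>"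

lemma rad_pos: "rad i > 0"
  using p_pos by (simp add: radix_def)

lemma digit_less: "dg t i < rad i"
  by (simp add: digit_eq rad_pos)

lemma digit_sum: "t < p ^ n \<Longrightarrow> t = (\<Sum>i\<le>n - \<delta>. dg t i * pl i)"
  unfolding sum_atMost_place using digit_expansion \<delta>_le by blast

lemma digit_sum_digits:
  assumes "\<And>i. i \<le> n - \<delta> \<Longrightarrow> s i < rad i"
  defines "t \<equiv> (\<Sum>i\<le>n - \<delta>. s i * pl i)"
  shows "t < p ^ n" "i \<le> n - \<delta> \<Longrightarrow> dg t i = s i"
proof -
  have "s i < p" if "1 \<le> i" "i \<le> n - \<delta>" for i
    using assms(1)[of i] that by (simp add: radix_def)
  then show "t < p ^ n" "i \<le> n - \<delta> \<Longrightarrow> dg t i = s i"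
    using digit_unique_aux[of p s \<delta> "n - \<delta>"] p_pos \<delta>_le assms(1)[of 0]
    by (simp_all add: t_def sum_atMost_place radix_def)
qed

lemma digits_eqI:
  assumes "t < p ^ n" "u < p ^ n" "\<And>i. i \<le> n - \<delta> \<Longrightarrow> dg t i = dg u i"
  shows "t = u"
proof -
  have "(\<Sum>i\<le>n - \<delta>. dg t i * pl i) = (\<Sum>i\<le>n - \<delta>. dg u i * pl i)"
    by (rule sum.cong) (simp_all add: assms(3))
  then show ?thesis using digit_sum[OF assms(1)] digit_sum[OF assms(2)] by metis
qed

text \<open>Addition without carries in the digit group. The vector has integer entries since
  exponents may be negative; the remainder by a positive radix is nonnegative, so \<open>nat\<close>
  loses nothing.\<close>

definition translate :: "(nat \<Rightarrow> int) \<Rightarrow> nat \<Rightarrow> nat" where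
  "translate e t = (\<Sum>i\<le>n - \<delta>. nat ((int (dg t i) + e i) mod int (rad i)) * pl i)"

lemma nat_mod_rad_less: "nat (k mod int (rad i)) < rad i"
  using rad_pos[of i] pos_mod_bound[of "int (rad i)" k] pos_mod_sign[of "int (rad i)" k] by linarith

lemma translate_less: "translate e t < p ^ n"
  unfolding translate_def by (rule digit_sum_digits) (rule nat_mod_rad_less)

lemma digit_translate:
  assumes "i \<le> n - \<delta>"
  shows "int (dg (translate e t) i) = (int (dg t i) + e i) mod int (rad i)"
proof -
  have "dg (translate e t) i = nat ((int (dg t i) + e i) mod int (rad i))"
    unfolding translate_def using assms nat_mod_rad_less by (intro digit_sum_digits)
  then show ?thesis using rad_pos[of i] by simp
qed

lemma translate_translate: "translate d (translate e t) = translate (\<lambda>i. d i + e i) t"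
proof (rule digits_eqI)
  fix i assume "i \<le> n - \<delta>"
  then have "int (dg (translate d (translate e t)) i) = int (dg (translate (\<lambda>i. d i + e i) t) i)"
    by (simp add: digit_translate mod_simps algebra_simps)
  then show "dg (translate d (translate e t)) i = dg (translate (\<lambda>i. d i + e i) t) i" by simp
qed (simp_all add: translate_less)

lemma translate_zero:
  assumes "t < p ^ n"
  shows "translate (\<lambda>_. 0) t = t"
proof (rule digits_eqI)
  fix i assume "i \<le> n - \<delta>"
  then have "int (dg (translate (\<lambda>_. 0) t) i) = int (dg t i)"
    using digit_less by (simp add: digit_translate)
  then show "dg (translate (\<lambda>_. 0) t) i = dg t i" by simp
qed (simp_all add: translate_less assms)

text \<open>Digits below their radices determine an index, so equalities of field elements turn into
  systems of congruences. Two base points are allowed because the injectivity of \<open>h\<close>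
  compares different ones.\<close>

lemma translate_eq_iff:
  "translate d s = translate e t \<longleftrightarrow>
    (\<forall>i\<le>n - \<delta>. [int (dg s i) + d i = int (dg t i) + e i] (mod int (rad i)))"
  (is "?L \<longleftrightarrow> ?R")
proof
  assume ?L
  then show ?R unfolding cong_def using digit_translate by metis
next
  assume R: ?R
  show ?L
  proof (rule digits_eqI)
    fix i assume "i \<le> n - \<delta>"
    then have "int (dg (translate d s) i) = int (dg (translate e t) i)"
      using R by (simp add: digit_translate cong_def)
    then show "dg (translate d s) i = dg (translate e t) i" by simp
  qed (simp_all add: translate_less)
qed

definition unit_vec :: "nat \<Rightarrow> nat \<Rightarrow> int" where
  "unit_vec i = (\<lambda>k. if k = i then 1 else 0)"

text \<open>All digits but the \<open>i\<close>-th form a common remainder \<open>?R\<close>. This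
  closed form is what the index arithmetic of a single cycle produces.\<close>

lemma translate_unit:
  assumes "t < p ^ n" "i \<le> n - \<delta>"
  shows "translate (unit_vec i) t = t - dg t i * pl i + Suc (dg t i) mod rad i * pl i"
proof -
  let ?s = "\<lambda>k. nat ((int (dg t k) + unit_vec i k) mod int (rad k))"
  have s: "?s k = dg t k" if "k \<noteq> i" for k
    using that digit_less by (simp add: unit_vec_def)
  have si: "?s i = Suc (dg t i) mod rad i"
    by (simp add: unit_vec_def nat_mod_distrib nat_add_distrib)
  let ?R = "\<Sum>k\<in>{..n - \<delta>} - {i}. dg t k * pl k"
  have "translate (unit_vec i) t = ?s i * pl i + (\<Sum>k\<in>{..n - \<delta>} - {i}. ?s k * pl k)"
    unfolding translate_def using assms(2) by (subst sum.remove[of _ i]) auto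
  also have "(\<Sum>k\<in>{..n - \<delta>} - {i}. ?s k * pl k) = ?R"
    by (rule sum.cong) (auto simp: s)
  finally have "translate (unit_vec i) t = Suc (dg t i) mod rad i * pl i + ?R"
    by (simp only: si)
  moreover have "t = dg t i * pl i + ?R"
    using digit_sum[OF assms(1)] assms(2) by (subst (asm) sum.remove[of _ i]) auto
  ultimately show ?thesis by simp
qed

section \<open>Transport of the translations to the field along the listing\<close>

definition index :: "'a \<Rightarrow> nat" where
  "index = the_inv_into {..<p ^ n} c"

lemma index_c: "t < p ^ n \<Longrightarrow> index (c t) = t"
  using bij_c by (auto simp: index_def bij_betw_def the_inv_into_f_f)

lemma c_index: "c (index x) = x" and index_less: "index x < p ^ n"
  using f_the_inv_into_f_bij_betw[OF bij_c, of x] bij_betwE[OF bij_betw_the_inv_into[OF bij_c]]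
  by (auto simp: index_def)

lemma c_eq_iff: "t < p ^ n \<Longrightarrow> u < p ^ n \<Longrightarrow> c t = c u \<longleftrightarrow> t = u"
  by (metis index_c)

definition shift :: "(nat \<Rightarrow> int) \<Rightarrow> 'a \<Rightarrow> 'a" where
  "shift e x = c (translate e (index x))"

lemma shift_c: "t < p ^ n \<Longrightarrow> shift e (c t) = c (translate e t)"
  by (simp add: shift_def index_c)

lemma shift_shift: "shift d (shift e x) = shift (\<lambda>i. d i + e i) x"
  by (simp add: shift_def index_c translate_less translate_translate)

lemma shift_zero: "shift (\<lambda>_. 0) = id"
  by (auto simp: shift_def translate_zero index_less c_index)

lemma inv_shift: "inv_into UNIV (shift e) = shift (\<lambda>i. - e i)" and bij_shift: "bij (shift e)"
proof -
  have *: "shift (\<lambda>i. - e i) \<circ> shift e = id" "shift e \<circ> shift (\<lambda>i. - e i) = id"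
    by (auto simp: shift_shift shift_zero)
  then show "bij (shift e)" by (metis o_bij)
  show "inv_into UNIV (shift e) = shift (\<lambda>i. - e i)" by (rule inv_unique_comp[OF *(2,1)])
qed

text \<open>The right side does not mention \<open>x\<close>: two translations agree everywhere or
  nowhere, which is the absence of fixed points in the group.\<close>

lemma shift_eq_iff:
  "shift d x = shift e x \<longleftrightarrow> (\<forall>i\<le>n - \<delta>. [d i = e i] (mod int (rad i)))"
  by (simp add: shift_def c_eq_iff translate_less translate_eq_iff cong_add_lcancel)

section \<open>The generators as unit translations\<close>

text \<open>Each cycle runs through a block of \<open>P\<close> consecutive indices, labelled by the
  quotient by \<open>P\<close>; one step along it increments digit 0 cyclically.\<close>

lemma gen_zero: "gen c p n \<delta> 0 = shift (unit_vec 0)"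
proof
  fix x :: 'a
  define P where "P = p ^ \<delta>"
  have P: "P > 0" "p ^ n = p ^ (n - \<delta>) * P"
    using p_pos \<delta>_le by (simp_all add: P_def flip: power_add)
  define C where "C = (\<lambda>j. cycle_of_list (map (\<lambda>k. c (j * P + k)) [0..<P]))"
  define r where "r x = index x div P" for x
  have less: "j * P + k < p ^ n" if "j < p ^ (n - \<delta>)" "k < P" for j k
  proof -
    have "j * P + k < Suc j * P" using that by simp
    also have "\<dots> \<le> p ^ n" unfolding P(2) using that by (intro mult_right_mono) auto
    finally show ?thesis .
  qed
  have perm: "C j permutes {x. r x = j}" if "j \<in> set [0..<p ^ (n - \<delta>)]" for j
    unfolding C_def using that P(1)
    by (intro permutes_subset[OF cycle_permutes]) (auto simp: r_def index_c less)
  define t where "t = index x"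
  have t: "t < p ^ n" "x = c t" by (simp_all add: t_def index_less c_index)
  have rt: "r x < p ^ (n - \<delta>)" using t P by (simp add: r_def index_c less_mult_imp_div_less)
  have "gen c p n \<delta> 0 x = C (r x) x"
    unfolding gen_def using perm_prod_fibres[of "[0..<p ^ (n - \<delta>)]" C r x] perm rt
    by (simp add: C_def P_def)
  also have "C (r x) x = C (r x) (c (r x * P + t mod P))" by (simp add: t r_def index_c)
  also have "\<dots> = c (r x * P + Suc (t mod P) mod P)"
    unfolding C_def using P(1) rt
    by (intro cycle_of_list_upt) (auto simp: inj_on_def c_eq_iff less)
  also have "\<dots> = shift (unit_vec 0) x"
    using t by (simp add: shift_c translate_unit digit_eq place_def radix_def P_def r_def index_c
      minus_mod_eq_div_mult)
  finally show "gen c p n \<delta> 0 x = shift (unit_vec 0) x" unfolding r_def index_c[OF t(1)]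
    by (simp add: t(2) index_c[OF t(1)])
qed

text \<open>The starting points \<open>js\<close> are the indices whose digit \<open>i\<close> is
  zero. A cycle is therefore labelled by its members with that digit cleared, and one step
  increments the digit cyclically.\<close>

lemma gen_pos:
  assumes "0 < i" "i \<le> n - \<delta>"
  shows "gen c p n \<delta> i = shift (unit_vec i)"
proof
  fix x :: 'a
  define W where "W = p ^ (i + \<delta> - 1)"
  define M where "M = p ^ (n - (i + \<delta>))"
  have pW: "p ^ (i + \<delta>) = W * p" unfolding W_def using assms(1)
    by (metis Suc_diff_1 add_gr_0 mult.commute power_Suc)
  have "n = n - (i + \<delta>) + (i + \<delta>)" using assms \<delta>_le by simp
  then have "p ^ n = M * p ^ (i + \<delta>)" unfolding M_def by (metis power_add)
  then have W: "W > 0" "p ^ n = M * (W * p)"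
    using p_pos unfolding pW by (simp_all add: W_def)
  have pl: "pl i = W" "rad i = p" using assms by (simp_all add: place_def radix_def W_def)
  define js where "js = filter (\<lambda>j. j mod (W * p) < W) [0..<p ^ n]"
  define C where "C = (\<lambda>j. cycle_of_list (map (\<lambda>k. c (j + k * W)) [0..<p]))"
  define r where "r x = index x - dg (index x) i * W" for x
  \<comment> \<open>With \<open>j = a * (W * p) + b\<close> and \<open>b < W\<close>, adding
    \<open>k * W\<close> writes \<open>k\<close> into the empty digit without a carry.\<close>
  have block: "j + k * W < p ^ n" "dg (j + k * W) i = k" if "j \<in> set js" "k < p" for j k
  proof -
    define a where "a = j div (W * p)"
    define b where "b = j mod (W * p)"
    have j: "j = a * (W * p) + b" "b < W" "j < p ^ n"
      using that div_mult_mod_eq[of j "W * p"] by (auto simp: a_def b_def js_def)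
    have "b + k * W < Suc k * W" using j by simp
    also have "\<dots> \<le> W * p" using that(2) by (subst mult.commute) (intro mult_left_mono, auto)
    finally have "j + k * W < Suc a * (W * p)" using j by simp
    also have "Suc a \<le> M" using j(3) unfolding W(2) a_def
      by (simp add: Suc_le_eq less_mult_imp_div_less)
    then have "Suc a * (W * p) \<le> p ^ n" unfolding W(2) by (rule mult_right_mono) simp
    finally show "j + k * W < p ^ n" .
    have "j + k * W = (a * p + k) * W + b" using j by (simp add: algebra_simps)
    then have "(j + k * W) div W = a * p + k" using j(2) by simp
    then show "dg (j + k * W) i = k" using that(2) by (simp add: digit_eq pl)
  qed
  have perm: "C j permutes {x. r x = j}" if "j \<in> set js" for j
    unfolding C_def using that
    by (intro permutes_subset[OF cycle_permutes]) (auto simp: r_def index_c block)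
  define t where "t = index x"
  have t: "t < p ^ n" "x = c t" by (simp_all add: t_def index_less c_index)
  \<comment> \<open>Isolates digit \<open>i\<close> of \<open>t\<close>, to show that clearing it
    leaves a remainder below \<open>W\<close> modulo \<open>W * p\<close>, hence a starting
    point.\<close>
  have "t mod (W * p) = W * dg t i + t mod W"
    by (simp add: mod_mult2_eq digit_eq pl)
  then have t_eq: "t = t div (W * p) * (W * p) + t mod W + dg t i * W"
    by (metis add.assoc add.commute div_mult_mod_eq mult.commute)
  then have rx: "r x = t div (W * p) * (W * p) + t mod W"
    unfolding r_def t_def[symmetric] by (metis add_diff_cancel_right')
  have "t mod W < W" using W(1) by simp
  moreover have "W \<le> W * p" using p_pos by simp
  ultimately have "r x mod (W * p) < W" unfolding rx by (simp add: less_le_trans)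
  then have rj: "r x \<in> set js" using index_less[of x] by (simp add: js_def r_def less_imp_diff_less)
  have dp: "dg t i < p" using digit_less[of t i] by (simp add: pl)
  have "i \<noteq> 0" using assms(1) by simp
  then have "gen c p n \<delta> i = perm_prod (map C js)"
    by (simp only: gen_def C_def js_def pW W_def[symmetric] if_False)
  moreover have "distinct js" by (simp add: js_def)
  ultimately have "gen c p n \<delta> i x = C (r x) x"
    using perm_prod_fibres[of js C r x] perm rj by simp
  also have "C (r x) x = C (r x) (c (r x + dg t i * W))"
    by (simp only: rx t_eq[symmetric] t(2)[symmetric])
  also have "\<dots> = c (r x + Suc (dg t i) mod p * W)"
    unfolding C_def using rj dp W(1)
    by (intro cycle_of_list_upt) (auto simp: inj_on_def c_eq_iff block)
  also have "\<dots> = shift (unit_vec i) x"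
    by (simp only: r_def shift_def t_def[symmetric] translate_unit[OF t(1) assms(2)] pl)
  finally show "gen c p n \<delta> i x = shift (unit_vec i) x" .
qed

lemma gen_eq_shift: "i \<le> n - \<delta> \<Longrightarrow> gen c p n \<delta> i = shift (unit_vec i)"
  using gen_zero gen_pos by (cases "i = 0") auto

section \<open>Powers and ordered products of translations\<close>

lemma shift_nat_pow: "shift e [^]\<^bsub>Sym\<^esub> (k :: nat) = shift (\<lambda>i. int k * e i)"
proof (induction k)
  case 0
  then show ?case by (simp add: one_BijGroup_UNIV shift_zero nat_pow_def)
next
  case (Suc k)
  interpret group "Sym :: ('a \<Rightarrow> 'a) monoid" by (rule group_BijGroup)
  have "shift e [^]\<^bsub>Sym\<^esub> Suc k = shift (\<lambda>i. int k * e i) \<circ> shift e"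
    by (simp add: Suc mult_BijGroup_UNIV bij_shift)
  then show ?case by (auto simp: shift_shift algebra_simps)
qed

lemma shift_int_pow: "shift e [^]\<^bsub>Sym\<^esub> (k :: int) = shift (\<lambda>i. k * e i)"
  by (simp add: int_pow_def2 shift_nat_pow inv_BijGroup_UNIV bij_shift inv_shift)

lemma perm_prod_shift:
  "perm_prod (map (\<lambda>i. shift (e i)) js) = shift (\<lambda>k. \<Sum>i\<leftarrow>js. e i k)"
proof (induction js)
  case Nil
  then show ?case by (simp add: perm_prod_Nil shift_zero)
next
  case (Cons j js)
  have "perm_prod (map (\<lambda>i. shift (e i)) (j # js)) = shift (e j) \<circ> perm_prod (map (\<lambda>i. shift (e i)) js)"
    by (auto intro!: perm_prod_Cons[of "shift (e j)", folded list.map(2)] simp: bij_shift)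
  then show ?case by (auto simp: Cons shift_shift)
qed

theorem gen_prod_eq_shift: "gen_prod c p n \<delta> e = shift e"
proof -
  have "map (\<lambda>i. gen c p n \<delta> i [^]\<^bsub>Sym\<^esub> e i) [0..<n - \<delta> + 1] =
      map (\<lambda>i. shift (\<lambda>k. e i * unit_vec i k)) [0..<n - \<delta> + 1]"
    by (rule map_cong) (auto simp: gen_eq_shift shift_int_pow)
  then have "gen_prod c p n \<delta> e = shift (\<lambda>k. \<Sum>i\<leftarrow>[0..<n - \<delta> + 1]. e i * unit_vec i k)"
    by (simp only: gen_prod_def perm_prod_shift)
  \<comment> \<open>The two vectors may differ beyond \<open>n - \<delta>\<close>, where the sum
    vanishes; \<open>shift\<close> ignores those entries.\<close>
  also have "\<dots> = shift e"
  proof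
    fix x
    have "(\<Sum>i\<leftarrow>[0..<n - \<delta> + 1]. e i * unit_vec i k) = e k" if "k \<le> n - \<delta>" for k
    proof -
      have "(\<Sum>i\<leftarrow>[0..<n - \<delta> + 1]. e i * unit_vec i k) =
          (\<Sum>i\<in>{..n - \<delta>}. if i = k then e i else 0)"
        unfolding interv_sum_list_conv_sum_set_nat
        by (rule sum.cong) (auto simp: unit_vec_def)
      then show ?thesis using that by simp
    qed
    then show "shift (\<lambda>k. \<Sum>i\<leftarrow>[0..<n - \<delta> + 1]. e i * unit_vec i k) x = shift e x"
      unfolding shift_eq_iff by simp
  qed
  finally show ?thesis .
qed

subsection \<open>Injectivity of the exponent maps\<close>

lemma digit_cong_iff:
  "[int (dg t i) = int (dg u i)] (mod int (rad i)) \<longleftrightarrow> dg t i = dg u i"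
  using digit_less[of t i] digit_less[of u i] by (simp add: cong_def)

lemma digit_two_bounds:
  assumes "p = 2"
  shows "0 < i \<Longrightarrow> int (dg t i) \<in> {0..<2}"
    and "\<delta> = 1 \<Longrightarrow> int (dg t i) \<in> {0..<2}"
    and "\<delta> = 2 \<Longrightarrow> int (dg t 0) \<in> {0..<4}"
  using digit_less[of t i] digit_less[of t 0] assms by (auto simp: radix_def split: if_splits)

text \<open>For odd \<open>p\<close> the exponents are the digits. For \<open>p = 2\<close> the
  previous systems apply, with \<open>n \<ge> 5\<close> supplying \<open>m \<ge> 3\<close> when
  \<delta> = 2. This will determine a solution from the values of \<open>f\<close> and
  \<open>g\<close>.\<close>

lemma h_exp_inj:
  assumes "prime p" "n \<ge> 2" "\<delta> \<in> {1, 2}" "p = 2 \<and> \<delta> = 2 \<longrightarrow> n \<ge> 5"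
    and tu: "t < p ^ n" "u < p ^ n"
    and cong: "\<And>i. i \<le> n - \<delta> \<Longrightarrow> [h_exp p n \<delta> t i = h_exp p n \<delta> u i] (mod int (rad i))"
  shows "t = u"
proof (rule digits_eqI[OF tu])
  fix i assume i: "i \<le> n - \<delta>"
  consider "odd p" | "p = 2" "\<delta> = 1" | "p = 2" "\<delta> = 2"
    using assms(1,3) prime_odd_nat[of p] prime_ge_2_nat[of p] by fastforce
  then have "int (dg t i) = int (dg u i)"
  proof cases
    case 1
    then show ?thesis using cong[OF i] by (simp add: h_exp_odd digit_cong_iff)
  next
    case 2
    show ?thesis
    proof (rule exponent1_inj[of "n - 1" "\<lambda>k. int (dg t k)" "\<lambda>k. int (dg u k)"])
      fix k assume "k \<le> n - 1"
      then show "[exponent1 (n - 1) (\<lambda>k. int (dg t k)) k = exponent1 (n - 1) (\<lambda>k. int (dg u k)) k] (mod 2)"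
        using cong[of k] by (simp add: 2 h_exp_two_one[simplified] radix_def split: if_splits)
    qed (use i 2 assms(2) digit_two_bounds(2) in auto)
  next
    case 3
    show ?thesis
    proof (rule exponent2_inj[of "n - 2" "\<lambda>k. int (dg t k)" "\<lambda>k. int (dg u k)"])
      show "[exponent2 (n - 2) (\<lambda>k. int (dg t k)) 0 = exponent2 (n - 2) (\<lambda>k. int (dg u k)) 0] (mod 4)"
        using cong[of 0] by (simp add: 3 h_exp_two_two radix_def)
      fix k :: nat assume "0 < k" "k \<le> n - 2"
      then show "[exponent2 (n - 2) (\<lambda>k. int (dg t k)) k = exponent2 (n - 2) (\<lambda>k. int (dg u k)) k] (mod 2)"
        using cong[of k] by (simp add: 3 h_exp_two_two radix_def)
    qed (use i 3 assms(4) digit_two_bounds(1,3) in auto)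
  qed
  then show "dg t i = dg u i" by simp
qed

text \<open>Since \<open>h\<close> adds the exponent vector to the digits, this is what makes
  \<open>h\<close> injective.\<close>

lemma digit_add_h_exp_inj:
  assumes "prime p" "n \<ge> 2" "\<delta> \<in> {1, 2}" "p = 2 \<and> \<delta> = 2 \<longrightarrow> n \<ge> 5"
    and tu: "t < p ^ n" "u < p ^ n"
    and cong: "\<And>i. i \<le> n - \<delta> \<Longrightarrow>
      [int (dg t i) + h_exp p n \<delta> t i = int (dg u i) + h_exp p n \<delta> u i] (mod int (rad i))"
  shows "t = u"
proof (rule digits_eqI[OF tu])
  fix i assume i: "i \<le> n - \<delta>"
  consider "odd p" | "p = 2" "\<delta> = 1" | "p = 2" "\<delta> = 2"
    using assms(1,3) prime_odd_nat[of p] prime_ge_2_nat[of p] by fastforce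
  then have "int (dg t i) = int (dg u i)"
  proof cases
    case 1
    \<comment> \<open>For odd \<open>p\<close> the map is doubling, which is invertible modulo each
      odd radix.\<close>
    then have "odd (rad i)" by (simp add: radix_def)
    then have "coprime 2 (int (rad i))" by simp
    moreover have "[2 * int (dg t i) = 2 * int (dg u i)] (mod int (rad i))"
      using cong[OF i] 1 by (simp add: h_exp_odd)
    ultimately show ?thesis by (simp add: cong_mult_lcancel digit_cong_iff)
  next
    case 2
    show ?thesis
    proof (rule exponent1_add_inj[of "n - 1" "\<lambda>k. int (dg t k)" "\<lambda>k. int (dg u k)"])
      fix k assume "k \<le> n - 1"
      then show "[int (dg t k) + exponent1 (n - 1) (\<lambda>k. int (dg t k)) k =
          int (dg u k) + exponent1 (n - 1) (\<lambda>k. int (dg u k)) k] (mod 2)"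
        using cong[of k] by (simp add: 2 h_exp_two_one[simplified] radix_def split: if_splits)
    qed (use i 2 assms(2) digit_two_bounds(2) in auto)
  next
    case 3
    show ?thesis
    proof (rule exponent2_add_inj[of "n - 2" "\<lambda>k. int (dg t k)" "\<lambda>k. int (dg u k)"])
      show "[int (dg t 0) + exponent2 (n - 2) (\<lambda>k. int (dg t k)) 0 =
          int (dg u 0) + exponent2 (n - 2) (\<lambda>k. int (dg u k)) 0] (mod 4)"
        using cong[of 0] by (simp add: 3 h_exp_two_two radix_def)
      fix k :: nat assume "0 < k" "k \<le> n - 2"
      then show "[int (dg t k) + exponent2 (n - 2) (\<lambda>k. int (dg t k)) k =
          int (dg u k) + exponent2 (n - 2) (\<lambda>k. int (dg u k)) k] (mod 2)"
        using cong[of k] by (simp add: 3 h_exp_two_two radix_def)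
    qed (use i 3 assms(4) digit_two_bounds(1,3) in auto)
  qed
  then show "dg t i = dg u i" by simp
qed

section \<open>The translations as a group given by digit vectors\<close>

text \<open>Translating 0 reduces every entry modulo its radix, so each translation is already given
  by the digits of some index.\<close>

lemma shift_digits: "shift e = shift (\<lambda>i. int (dg (translate e 0) i))"
proof
  fix x
  have "[e i = int (dg (translate e 0) i)] (mod int (rad i))" if "i \<le> n - \<delta>" for i
    using that digit_translate[of i e 0] digit_zero[of p \<delta> i] by (simp add: cong_def)
  then show "shift e x = shift (\<lambda>i. int (dg (translate e 0) i)) x"
    by (simp add: shift_eq_iff)
qed

text \<open>Letting the vectors run over all integers makes closure immediate, with no bounds on
  exponents to restore.\<close>

lemma subgroup_range_shift: "subgroup (range shift) Sym"
proof -
  interpret group "Sym :: ('a \<Rightarrow> 'a) monoid" by (rule group_BijGroup)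
  show ?thesis
  proof (rule subgroupI)
    show "range shift \<subseteq> carrier Sym" by (auto simp: carrier_BijGroup_UNIV bij_shift)
  next
    fix a :: "'a \<Rightarrow> 'a" assume "a \<in> range shift"
    then show "inv\<^bsub>Sym\<^esub> a \<in> range shift" by (auto simp: inv_BijGroup_UNIV bij_shift inv_shift)
  next
    fix a b :: "'a \<Rightarrow> 'a" assume "a \<in> range shift" "b \<in> range shift"
    then obtain d e where "a = shift d" "b = shift e" by auto
    then have "a \<otimes>\<^bsub>Sym\<^esub> b = shift (\<lambda>i. d i + e i)"
      by (auto simp: mult_BijGroup_UNIV bij_shift shift_shift)
    then show "a \<otimes>\<^bsub>Sym\<^esub> b \<in> range shift" by simp
  qed simp
qed

end

section \<open>The tuples of \<open>f\<close> and \<open>g\<close> and their orthogonality\<close>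

theorem theorem3p5:
  fixes c :: "nat \<Rightarrow> 'a :: {field, finite}"
    and p n \<delta> :: nat
    and \<beta> :: "nat \<Rightarrow> 'a \<Rightarrow> 'a"
    and h :: "'a \<Rightarrow> 'a"
    and f g :: "'a poly poly"
  assumes "prime p" and "n \<ge> 2" and "CARD('a) = p ^ n"
    and "bij_betw c {..<p ^ n} UNIV"
    and "\<delta> \<in> {1, 2}" and "p = 2 \<and> \<delta> = 2 \<longrightarrow> n \<ge> 5"
    and "\<And>t. t < p ^ n \<Longrightarrow> \<beta> t = gen_prod c p n \<delta> (\<lambda>i. int (digit p \<delta> t i))"
    and "f = lpp_of_tuple c \<beta>"
    and "\<And>t. t < p ^ n \<Longrightarrow> h (c t) = gen_prod c p n \<delta> (h_exp p n \<delta> t) (c t)"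
    and "g = lpp_of_tuple c (\<lambda>t. h \<circ> \<beta> t)"
  shows "permutation_group_polynomial c f \<and> has_tuple c f \<beta> \<and>
    has_tuple c g (\<lambda>t. h \<circ> \<beta> t) \<and> companions g f"
proof -
  interpret listing c p n \<delta>
    using assms(1,2,4,5) by unfold_locales (auto simp: prime_gt_0_nat)
  have \<beta>: "\<beta> t = shift (\<lambda>i. int (dg t i))" if "t < p ^ n" for t
    using assms(7)[OF that] by (simp only: gen_prod_eq_shift)
  have h: "h (c t) = c (translate (h_exp p n \<delta> t) t)" if "t < p ^ n" for t
    using assms(9)[OF that] that by (simp only: gen_prod_eq_shift shift_c)
  have c_cases: "\<exists>t<p ^ n. x = c t" for x
    using c_index[of x] index_less[of x] by metis
  have \<beta>_neq: "\<beta> i x \<noteq> \<beta> j x" if "i < p ^ n" "j < p ^ n" "i \<noteq> j" for i j x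
    using that digits_eqI[of i j] by (auto simp: \<beta> shift_eq_iff digit_cong_iff)
  have tuple_\<beta>: "permutation_polynomial_tuple \<beta>"
    unfolding permutation_polynomial_tuple_iff assms(3) using \<beta> \<beta>_neq by (simp add: bij_shift)
  have "inj h"
  proof (rule injI)
    fix x y assume "h x = h y"
    moreover obtain t u where tu: "t < p ^ n" "u < p ^ n" "x = c t" "y = c u"
      using c_cases by metis
    ultimately have "translate (h_exp p n \<delta> t) t = translate (h_exp p n \<delta> u) u"
      by (simp add: h c_eq_iff translate_less)
    then have "t = u"
      unfolding translate_eq_iff using digit_add_h_exp_inj[OF assms(1,2,5,6) tu(1,2)] by blast
    then show "x = y" using tu by simp
  qed
  then have bij_h: "bij h" by (simp add: bij_def finite_UNIV_inj_surj)
  have tuple_h\<beta>: "permutation_polynomial_tuple (\<lambda>t. h \<circ> \<beta> t)"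
    unfolding permutation_polynomial_tuple_iff assms(3)
  proof (intro conjI allI impI)
    fix i assume "i < p ^ n"
    then show "bij (h \<circ> \<beta> i)" by (simp add: \<beta> bij_comp bij_shift bij_h)
  next
    fix i j x assume "i < p ^ n" "j < p ^ n" "i \<noteq> j"
    then show "(h \<circ> \<beta> i) x \<noteq> (h \<circ> \<beta> j) x"
      using \<beta>_neq \<open>inj h\<close> by (simp add: inj_eq)
  qed
  have bij_c': "bij_betw c {..<CARD('a)} UNIV" using assms(3,4) by simp
  have f: "local_permutation_polynomial f" "has_tuple c f \<beta>"
    using theI'[OF ex1_lpp_of_tuple[OF bij_c' tuple_\<beta>]] by (simp_all add: assms(8) lpp_of_tuple_def)
  have g: "local_permutation_polynomial g" "has_tuple c g (\<lambda>t. h \<circ> \<beta> t)"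
    using theI'[OF ex1_lpp_of_tuple[OF bij_c' tuple_h\<beta>]] by (simp_all add: assms(10) lpp_of_tuple_def)
  have "\<beta> ` {..<CARD('a)} = range shift"
  proof
    show "\<beta> ` {..<CARD('a)} \<subseteq> range shift" using \<beta> by (auto simp: assms(3))
  next
    have "shift e = \<beta> (translate e 0)" for e
      using \<beta>[OF translate_less] shift_digits by metis
    then show "range shift \<subseteq> \<beta> ` {..<CARD('a)}"
      by (auto simp: assms(3) translate_less)
  qed
  then have group_f: "permutation_group_polynomial c f"
    unfolding permutation_group_polynomial_def using f subgroup_range_shift by auto
  have f_val: "eval2 f x (\<beta> i x) = c i" and g_val: "eval2 g x (h (\<beta> i x)) = c i"
    if "i < p ^ n" for i x
    using f(2) g(2) that by (simp_all add: has_tuple_def assms(3))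
  have \<beta>_surj: "\<exists>i<p ^ n. \<beta> i x = y" for x y
    using bij_betw_imp_surj_on[OF bij_betw_permutation_polynomial_tuple[OF tuple_\<beta>], of x]
    by (metis (no_types, lifting) UNIV_I assms(3) imageE lessThan_iff)
  \<comment> \<open>Orthogonality says that \<open>F\<close> is bijective; on a finite set
    injectivity suffices.\<close>
  define F where "F z = (eval2 g (fst z) (snd z), eval2 f (fst z) (snd z))" for z
  \<comment> \<open>\<open>s\<close> indexes the first coordinate and \<open>t\<close> the preimage
    of the second under \<open>h\<close>. From \<open>c s\<close>, \<beta>\<open>j\<close> leads to
    the second coordinate and \<beta>\<open>i\<close> to \<open>c t\<close>, so \<open>f\<close>
    takes the value \<open>c j\<close> and \<open>g\<close> the value \<open>c i\<close>. Comparing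
    both routes and cancelling the digits of \<open>s\<close> gives the congruence.\<close>
  have coords: "\<exists>s<p ^ n. \<exists>i<p ^ n. \<exists>j<p ^ n. \<exists>t<p ^ n.
      z = (c s, h (c t)) \<and> c t = \<beta> i (c s) \<and> F z = (c i, c j) \<and>
      (\<forall>k\<le>n - \<delta>. [h_exp p n \<delta> t k + int (dg i k) = int (dg j k)] (mod int (rad k)))" for z
  proof -
    obtain s where s: "s < p ^ n" "fst z = c s" using c_cases by metis
    obtain j where j: "j < p ^ n" "snd z = \<beta> j (c s)" using \<beta>_surj by metis
    obtain v where v: "snd z = h v" using bij_h by (metis bij_pointE)
    obtain i where i: "i < p ^ n" "\<beta> i (c s) = v" using \<beta>_surj by metis
    define t where "t = translate (\<lambda>k. int (dg i k)) s"
    have t: "t < p ^ n" "v = c t" using i s by (auto simp: t_def translate_less \<beta> shift_c)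
    have "c (translate (h_exp p n \<delta> t) t) = c (translate (\<lambda>k. int (dg j k)) s)"
      using v j s t by (simp add: h \<beta> shift_c)
    then have "translate (\<lambda>k. h_exp p n \<delta> t k + int (dg i k)) s = translate (\<lambda>k. int (dg j k)) s"
      by (simp add: c_eq_iff translate_less translate_translate[symmetric] t_def[symmetric])
    then have "\<forall>k\<le>n - \<delta>. [h_exp p n \<delta> t k + int (dg i k) = int (dg j k)] (mod int (rad k))"
      by (simp only: translate_eq_iff cong_add_lcancel)
    moreover have "F z = (c i, c j)"
      using f_val[OF j(1), of "c s"] g_val[OF i(1), of "c s"] by (simp add: F_def s j(2)[symmetric] v[symmetric] i(2))
    ultimately show ?thesis using s i j t v by (metis prod.collapse)
  qed
  have "inj F"
  proof (rule injI)
    fix z z' assume eq: "F z = F z'"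
    obtain s i j t where z: "s < p ^ n" "i < p ^ n" "j < p ^ n" "t < p ^ n" "z = (c s, h (c t))"
      "c t = \<beta> i (c s)" "F z = (c i, c j)"
      "\<And>k. k \<le> n - \<delta> \<Longrightarrow> [h_exp p n \<delta> t k + int (dg i k) = int (dg j k)] (mod int (rad k))"
      using coords[of z] by blast
    obtain s' i' j' t' where z': "s' < p ^ n" "i' < p ^ n" "j' < p ^ n" "t' < p ^ n" "z' = (c s', h (c t'))"
      "c t' = \<beta> i' (c s')" "F z' = (c i', c j')"
      "\<And>k. k \<le> n - \<delta> \<Longrightarrow> [h_exp p n \<delta> t' k + int (dg i' k) = int (dg j' k)] (mod int (rad k))"
      using coords[of z'] by blast
    \<comment> \<open>The values of \<open>F\<close> fix \<open>i\<close> and \<open>j\<close>,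
      hence the exponents at \<open>t\<close> modulo the radices, hence \<open>t\<close>; then
      \<open>s\<close> follows as \<beta>\<open>i\<close> is injective.\<close>
    have ij: "i' = i" "j' = j" using eq z(2,3,7) z'(2,3,7) by (auto simp: c_eq_iff)
    have "[h_exp p n \<delta> t k = h_exp p n \<delta> t' k] (mod int (rad k))" if "k \<le> n - \<delta>" for k
      using cong_trans[OF z(8)[OF that] cong_sym[OF z'(8)[OF that, unfolded ij]]]
      by (simp only: cong_add_rcancel)
    then have t: "t = t'" by (rule h_exp_inj[OF assms(1,2,5,6) z(4) z'(4)])
    have "inj (\<beta> i)" using \<beta>[OF z(2)] bij_shift by (simp add: bij_is_inj)
    then have "c s = c s'" using z(6) z'(6) t ij by (simp add: inj_eq)
    then show "z = z'" using z(5) z'(5) t by simp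
  qed
  then have "bij F" by (simp add: bij_def finite_UNIV_inj_surj)
  then have "\<exists>!z. F z = (a, b)" for a b by (metis bij_pointE)
  then have "companions g f" unfolding companions_def F_def using f(1) g(1) by simp
  then show ?thesis using group_f f(2) g(2) by simp
qed

end
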